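(* For $k \geq 2$, let $ex_{out}(n;k)$ denote the largest size (number of arcs) of an out-regular $k$-geodetic digraph with order $n$. Then $ex_{out}(n;k) \sim n^{\frac{k+1}{k}}$ as $n \rightarrow \infty$.
   Context: A digraph has a vertex set and an arc set consisting of ordered pairs of distinct vertices (no loops, no multiple arcs). A walk of length $\ell$ is a sequence $x_0x_1\dots x_\ell$ of vertices with $x_i \rightarrow x_{i+1}$ for all $i$. A digraph is $k$-geodetic if for every ordered pair $(u,v)$ of (not necessarily distinct) vertices there is at most one $u,v$-walk of length at most $k$ (the trivial walk of length $0$ counts when $u=v$). A digraph is out-regular if all vertices have the same out-degree. The size of a digraph is its number of arcs and its order is its number of vertices. *)

theory Defs
  imports
    Complex_Main
    "HOL-Library.Landau_Symbols"
    "Graph_Theory.Pair_Digraph"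
    "Graph_Theory.Vertex_Walk"
begin

text \<open>
  Digraphs are those of the locale \<open>pair_digraph\<close>: finitely many vertices, and an arc set
  consisting of ordered pairs of distinct vertices. Walks are the vertex sequences of \<open>vwalk\<close>;
  they may repeat vertices and arcs, and \<open>[u]\<close> is the trivial walk of length 0 at \<open>u\<close>.
\<close>

definition uv_walk :: "'a pair_pre_digraph \<Rightarrow> 'a \<Rightarrow> 'a vwalk \<Rightarrow> 'a \<Rightarrow> bool" where
  "uv_walk G u p v \<longleftrightarrow> vwalk p (with_proj G) \<and> hd p = u \<and> last p = v"

definition k_geodetic :: "nat \<Rightarrow> 'a pair_pre_digraph \<Rightarrow> bool" where
  "k_geodetic k G \<longleftrightarrow>
     (\<forall>u \<in> pverts G. \<forall>v \<in> pverts G. \<forall>p q.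
        uv_walk G u p v \<and> vwalk_length p \<le> k \<and>
        uv_walk G u q v \<and> vwalk_length q \<le> k \<longrightarrow> p = q)"

definition out_regular :: "'a pair_pre_digraph \<Rightarrow> bool" where
  "out_regular G \<longleftrightarrow> (\<exists>d. \<forall>v \<in> pverts G. out_degree (with_proj G) v = d)"

text \<open>
  The possible sizes of an out-regular \<open>k\<close>-geodetic digraph of order \<open>n\<close>. Taking vertices in
  \<open>nat\<close> loses nothing, as every finite digraph is isomorphic to one of these.
\<close>

definition out_sizes :: "nat \<Rightarrow> nat \<Rightarrow> nat set" where
  "out_sizes n k = {card (parcs G) | G :: nat pair_pre_digraph.
     pair_digraph G \<and> card (pverts G) = n \<and> out_regular G \<and> k_geodetic k G}"

definition ex_out :: "nat \<Rightarrow> nat \<Rightarrow> nat" where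
  "ex_out n k = Max (out_sizes n k)"

text \<open>The maximum is that of a finite nonempty set.\<close>

lemma finite_out_sizes: "finite (out_sizes n k)"
proof (rule finite_subset)
  show "out_sizes n k \<subseteq> {..n * n}"
  proof
    fix m assume "m \<in> out_sizes n k"
    then obtain G :: "nat pair_pre_digraph" where
      G: "pair_digraph G" "card (pverts G) = n" "m = card (parcs G)"
      unfolding out_sizes_def by blast
    interpret pair_digraph G by (rule G(1))
    have "parcs G \<subseteq> pverts G \<times> pverts G"
      by (auto dest: in_arcsD1 in_arcsD2)
    then have "card (parcs G) \<le> card (pverts G \<times> pverts G)"
      by (intro card_mono finite_cartesian_product pair_finite_verts)
    then show "m \<in> {..n * n}"
      by (simp add: G card_cartesian_product)
  qed
qed simp

lemma out_sizes_nonempty: "out_sizes n k \<noteq> {}"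
proof -
  let ?G = "\<lparr> pverts = {..<n}, parcs = {} \<rparr> :: nat pair_pre_digraph"
  have "pair_digraph ?G"
    by unfold_locales auto
  moreover have "out_regular ?G"
    by (auto simp: out_regular_def out_degree_def out_arcs_def)
  moreover have walk: "p = [u]" if "uv_walk ?G u p v" for u p v
    using that by (cases p rule: vwalk_arcs.cases) (auto simp: uv_walk_def vwalk_def)
  then have "k_geodetic k ?G"
    unfolding k_geodetic_def by metis
  ultimately have "card (parcs ?G) \<in> out_sizes n k"
    unfolding out_sizes_def by (intro CollectI exI[of _ ?G]) simp
  then show ?thesis by blast
qed

end

theory Submission
  imports Defs "HOL-Real_Asymp.Real_Asymp"
begin

text \<open>
  Upper bound: if all out-degrees are \<open>d\<close>, the \<open>d ^ k\<close> walks of length \<open>k\<close> leaving a fixed vertex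
  have distinct ends, so \<open>d ^ k \<le> n\<close> and the size is \<open>n * d \<le> n * n powr (1 / k)\<close>.

  Lower bound: put \<open>m = \<lfloor>n powr (1 / k)\<rfloor>\<close> and consider the permutation digraph on the \<open>k\<close>-lists of
  distinct symbols below \<open>m\<close>, with arcs from \<open>x\<close> to \<open>tl x @ [a]\<close> for the \<open>m - k\<close> symbols \<open>a\<close> not in
  \<open>x\<close>. It is \<open>k\<close>-geodetic: the end of a walk is the initial list with a prefix dropped and the
  symbols read appended, and the first symbol of this list betrays the length. It has at most
  \<open>m ^ k \<le> n\<close> vertices; each missing vertex is added as a source with the same out-neighbours as
  some existing vertex, which preserves both \<open>k\<close>-geodecity and the out-degree.
\<close>

section \<open>Counting arcs and walks in out-regular digraphs; the upper bound\<close>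

lemma vwalk_singleton_iff: "vwalk [u] G \<longleftrightarrow> u \<in> verts G"
  by (auto simp: vwalk_def)

lemma vwalk_Cons_Cons_iff:
  "vwalk (u # v # p) G \<longleftrightarrow> u \<in> verts G \<and> (u, v) \<in> arcs_ends G \<and> vwalk (v # p) G"
  by (auto simp: vwalk_def)

lemma (in pair_wf_digraph) card_out_neighbours:
  "card {v. (u, v) \<in> parcs G} = out_degree (with_proj G) u"
proof -
  have "out_arcs (with_proj G) u = Pair u ` {v. (u, v) \<in> parcs G}"
    by (auto simp: out_arcs_def)
  then show ?thesis
    by (simp add: out_degree_def card_image inj_on_def)
qed

lemma (in pair_fin_digraph) card_parcs_regular:
  assumes "\<And>v. v \<in> pverts G \<Longrightarrow> out_degree (with_proj G) v = d"
  shows "card (parcs G) = card (pverts G) * d"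
proof -
  have fin: "finite {v. (u, v) \<in> parcs G}" for u
    by (rule finite_subset[of _ "pverts G"]) (auto dest: in_arcsD2)
  have "parcs G = (SIGMA u:pverts G. {v. (u, v) \<in> parcs G})"
    by (auto dest: in_arcsD1)
  then have "card (parcs G) = card (SIGMA u:pverts G. {v. (u, v) \<in> parcs G})"
    by (rule arg_cong)
  also have "\<dots> = (\<Sum>u\<in>pverts G. card {v. (u, v) \<in> parcs G})"
    using fin by (intro card_SigmaI) auto
  also have "\<dots> = card (pverts G) * d"
    by (simp add: card_out_neighbours assms)
  finally show ?thesis .
qed

text \<open>Splitting off the first arc matches walks of length \<open>Suc l\<close> with pairs of
  an out-neighbour of \<open>u\<close> and a walk of length \<open>l\<close> from it.\<close>

lemma (in pair_fin_digraph) card_vwalks_regular: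
  assumes "\<And>v. v \<in> pverts G \<Longrightarrow> out_degree (with_proj G) v = d" and "u \<in> pverts G"
  shows "card {p. vwalk (u # p) (with_proj G) \<and> length p = l} = d ^ l"
  using assms(2)
proof (induction l arbitrary: u)
  case 0
  then have "{p. vwalk (u # p) (with_proj G) \<and> length p = 0} = {[]}"
    by (auto simp: vwalk_singleton_iff)
  then show ?case by simp
next
  case (Suc l)
  let ?W = "\<lambda>u l. {p. vwalk (u # p) (with_proj G) \<and> length p = l}"
  have eq: "?W u (Suc l) = (\<lambda>(v, p). v # p) ` (SIGMA v:{v. (u, v) \<in> parcs G}. ?W v l)"
    using Suc.prems by (auto simp: length_Suc_conv vwalk_Cons_Cons_iff image_iff)
  have fin: "finite {v. (u, v) \<in> parcs G}"
    by (rule finite_subset[of _ "pverts G"]) (auto dest: in_arcsD2)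
  have finW: "finite (?W v l)" for v
    by (rule finite_subset[OF _ finite_lists_length_eq[OF pair_finite_verts, of l]])
       (auto simp: vwalk_def)
  have "card (?W u (Suc l)) = card (SIGMA v:{v. (u, v) \<in> parcs G}. ?W v l)"
    unfolding eq by (intro card_image) (auto simp: inj_on_def)
  also have "\<dots> = (\<Sum>v\<in>{v. (u, v) \<in> parcs G}. card (?W v l))"
    using fin finW by (intro card_SigmaI) auto
  also have "\<dots> = (\<Sum>v\<in>{v. (u, v) \<in> parcs G}. d ^ l)"
    by (intro sum.cong refl Suc.IH) (auto dest: in_arcsD2)
  also have "\<dots> = d ^ Suc l"
    using Suc.prems by (simp add: card_out_neighbours assms(1))
  finally show ?case .
qed

lemma (in pair_fin_digraph) k_geodetic_degree_le:
  assumes "\<And>v. v \<in> pverts G \<Longrightarrow> out_degree (with_proj G) v = d"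
    and "k_geodetic k G" and "pverts G \<noteq> {}"
  shows "d ^ k \<le> card (pverts G)"
proof -
  obtain u where u: "u \<in> pverts G" using assms(3) by blast
  let ?W = "{p. vwalk (u # p) (with_proj G) \<and> length p = k}"
  have last: "last (u # p) \<in> pverts G" if "p \<in> ?W" for p
    using that last_in_set[of "u # p"] by (auto simp: vwalk_def simp del: last.simps)
  have "inj_on (\<lambda>p. last (u # p)) ?W"
  proof (rule inj_onI)
    fix p q assume *: "p \<in> ?W" "q \<in> ?W" "last (u # p) = last (u # q)"
    then have "uv_walk G u (u # p) (last (u # p))" "uv_walk G u (u # q) (last (u # p))"
      by (simp_all add: uv_walk_def)
    moreover have "vwalk_length (u # p) \<le> k" "vwalk_length (u # q) \<le> k"
      using * by simp_all
    ultimately have "u # p = u # q"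
      using assms(2) u last[OF *(1)] unfolding k_geodetic_def by blast
    then show "p = q" by simp
  qed
  then have "card ?W \<le> card (pverts G)"
    using last by (intro card_inj_on_le[where f = "\<lambda>p. last (u # p)"]) (auto simp del: last.simps)
  then show ?thesis
    using card_vwalks_regular[OF assms(1) u] by simp
qed

lemma ex_out_le:
  assumes "k > 0"
  shows "real (ex_out n k) \<le> real n * real n powr (1 / real k)"
proof -
  have "ex_out n k \<in> out_sizes n k"
    unfolding ex_out_def by (intro Max_in finite_out_sizes out_sizes_nonempty)
  then obtain G :: "nat pair_pre_digraph" where
    G: "pair_digraph G" "card (pverts G) = n" "out_regular G" "k_geodetic k G"
    and size: "ex_out n k = card (parcs G)"
    unfolding out_sizes_def by blast
  interpret pair_digraph G by (rule G(1))
  obtain d where d: "\<And>v. v \<in> pverts G \<Longrightarrow> out_degree (with_proj G) v = d"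
    using G(3) unfolding out_regular_def by blast
  have eq: "ex_out n k = n * d"
    using card_parcs_regular[OF d] size G(2) by simp
  show ?thesis
  \<comment> \<open>The bound on \<open>d\<close> needs a starting vertex; without one the size
    \<open>n * d\<close> is 0.\<close>
  proof (cases "n = 0")
    case False
    then have "d ^ k \<le> n"
      using k_geodetic_degree_le[OF d G(4)] G(2) by force
    then have "real d ^ k \<le> real n"
      by (metis of_nat_le_iff of_nat_power)
    then have "real d \<le> root k (real n)"
      using assms real_root_le_mono[of k "real d ^ k" "real n"] by (simp add: real_root_power_cancel)
    also have "root k (real n) = real n powr (1 / real k)"
      using assms False by (simp add: root_powr_inverse)
    finally show ?thesis
      by (simp add: eq mult_left_mono)
  qed (use eq in simp)
qed

section \<open>The permutation digraph with added sources\<close>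

text \<open>\<open>f\<close> assigns a list to each vertex and \<open>g\<close> picks one
  representative per list. As \<open>f\<close> need not be injective, there is room for added
  vertices and the order is exactly \<open>n\<close>.\<close>

locale permutation_labelling =
  fixes n m k :: nat and f :: "nat \<Rightarrow> nat list" and g :: "nat list \<Rightarrow> nat"
  assumes k_pos: "k > 0"
    and label: "\<And>i. i < n \<Longrightarrow> distinct (f i) \<and> length (f i) = k \<and> set (f i) \<subseteq> {..<m}"
    and vertex: "\<And>x. distinct x \<Longrightarrow> length x = k \<Longrightarrow> set x \<subseteq> {..<m} \<Longrightarrow> g x < n \<and> f (g x) = x"
begin

text \<open>Targets are always representatives, so no arc enters an added vertex.\<close>

definition shift :: "nat \<Rightarrow> nat \<Rightarrow> nat" where
  "shift i a = g (tl (f i) @ [a])"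

text \<open>
  Vertices outside the range of \<open>g\<close> are the added sources; such an \<open>i\<close> copies the out-neighbours
  of \<open>g (f i)\<close>.
\<close>

definition G :: "nat pair_pre_digraph" where
  "G = \<lparr> pverts = {..<n}, parcs = {(i, shift i a) | i a. i < n \<and> a < m \<and> a \<notin> set (f i)} \<rparr>"

lemma shift_props:
  assumes "i < n" "a < m" "a \<notin> set (f i)"
  shows "shift i a < n" "f (shift i a) = tl (f i) @ [a]"
proof -
  have "set (tl (f i)) \<subseteq> set (f i)"
    by (cases "f i") auto
  then have "g (tl (f i) @ [a]) < n \<and> f (g (tl (f i) @ [a])) = tl (f i) @ [a]"
    using label[OF assms(1)] assms k_pos by (intro vertex) (auto simp: distinct_tl)
  then show "shift i a < n" "f (shift i a) = tl (f i) @ [a]"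
    by (simp_all add: shift_def)
qed

lemma arcD:
  assumes "(i, j) \<in> parcs G"
  shows "i < n" "j < n" "f j = tl (f i) @ [last (f j)]" "last (f j) \<notin> set (f i)"
    "j = shift i (last (f j))"
  using assms by (auto simp: G_def shift_props)

lemma pair_digraph_G: "pair_digraph G"
proof
  show "finite (pverts G)" by (simp add: G_def)
  have "parcs G \<subseteq> {..<n} \<times> {..<n}" using arcD(1,2) by auto
  then show "finite (parcs G)" by (rule finite_subset) simp
  fix e assume e: "e \<in> parcs G"
  obtain i j where ij: "e = (i, j)" by (cases e)
  note arc = arcD[OF e[unfolded ij]]
  show "fst e \<in> pverts G" "snd e \<in> pverts G"
    using arc by (simp_all add: ij G_def)
  \<comment> \<open>A loop would put this symbol into \<open>f i\<close>, but an arc reads a symbol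
    outside \<open>f i\<close>.\<close>
  have "last (f j) \<in> set (f j)"
    using label[OF arc(2)] k_pos by (intro last_in_set) auto
  then show "fst e \<noteq> snd e"
    using arc by (auto simp: ij)
qed

sublocale pair_digraph G by (rule pair_digraph_G)

lemma out_degree_G:
  assumes "i \<in> pverts G"
  shows "out_degree (with_proj G) i = m - k"
proof -
  have i: "i < n" using assms by (simp add: G_def)
  have "{j. (i, j) \<in> parcs G} = shift i ` ({..<m} - set (f i))"
    using i by (auto simp: G_def)
  \<comment> \<open>The symbol read is recovered as the last entry of the target's list.\<close>
  moreover have "inj_on (shift i) ({..<m} - set (f i))"
    using shift_props(2)[OF i] by (intro inj_on_inverseI[where g = "\<lambda>j. last (f j)"]) auto
  moreover have "card ({..<m} - set (f i)) = m - k"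
    using label[OF i] by (simp add: card_Diff_subset distinct_card)
  ultimately show ?thesis
    by (simp flip: card_out_neighbours add: card_image)
qed

text \<open>Each arc drops the first entry and appends the symbol read; within \<open>k\<close> arcs
  only entries of the initial list are dropped.\<close>

lemma label_last:
  assumes "vwalk (u # p) (with_proj G)" "length p \<le> k"
  shows "f (last (u # p)) = drop (length p) (f u) @ map (\<lambda>v. last (f v)) p"
  using assms
proof (induction p arbitrary: u)
  case (Cons v p)
  then have arc: "(u, v) \<in> parcs G" and walk: "vwalk (v # p) (with_proj G)"
    by (auto simp: vwalk_Cons_Cons_iff)
  have "length (tl (f u)) = k - 1"
    using label[OF arcD(1)[OF arc]] by simp
  then have "drop (length p) (f v) = drop (Suc (length p)) (f u) @ [last (f v)]"
    using Cons.prems(2) by (subst arcD(3)[OF arc]) (simp add: drop_Suc)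
  then show ?case
    using Cons.IH[OF walk] Cons.prems(2) by simp
qed simp

text \<open>Labels alone do not determine vertices, but the target of an arc is \<open>shift\<close>
  of its source and the symbol read.\<close>

lemma vwalk_eqI:
  assumes "vwalk (u # p) (with_proj G)" "vwalk (u # q) (with_proj G)"
    and "map (\<lambda>v. last (f v)) p = map (\<lambda>v. last (f v)) q"
  shows "p = q"
  using assms
proof (induction p arbitrary: u q)
  case (Cons v p)
  then obtain w q' where q: "q = w # q'" by (cases q) auto
  have "(u, v) \<in> parcs G" "(u, w) \<in> parcs G"
    using Cons.prems by (auto simp: q vwalk_Cons_Cons_iff)
  then have "v = w"
    using arcD(5)[of u v] arcD(5)[of u w] Cons.prems(3) by (simp add: q)
  then show ?case
    using Cons.IH[of v q'] Cons.prems by (simp add: q vwalk_Cons_Cons_iff)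
qed simp

text \<open>
  With \<open>x = f u\<close>, a walk of length \<open>l < k\<close> ends at a list beginning with \<open>x ! l\<close>; a longer one ends
  at a list beginning with a later entry of \<open>x\<close>, or with a symbol not in \<open>x\<close>.
\<close>

lemma no_shorter_vwalk:
  assumes "vwalk (u # p) (with_proj G)" "vwalk (u # q) (with_proj G)"
    and "length p < length q" "length q \<le> k"
  shows "last (u # p) \<noteq> last (u # q)"
proof
  assume eq: "last (u # p) = last (u # q)"
  let ?s = "\<lambda>v. last (f v)"
  have u: "u < n" using assms(1) by (auto simp: vwalk_def G_def)
  note lab = label[OF u]
  have "drop (length p) (f u) @ map ?s p = drop (length q) (f u) @ map ?s q"
    using label_last[OF assms(1)] label_last[OF assms(2)] eq assms(3,4) by simp
  then have "(drop (length p) (f u) @ map ?s p) ! 0 = (drop (length q) (f u) @ map ?s q) ! 0"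
    by simp
  then have hd_eq: "f u ! length p = (drop (length q) (f u) @ map ?s q) ! 0"
    using assms(3,4) lab by (simp add: nth_append)
  have "f u ! length p \<in> set (f u)" using assms(3,4) lab by simp
  moreover obtain v q' where q: "q = v # q'" using assms(3) by (cases q) auto
  moreover have "?s v \<notin> set (f u)"
    using assms(2) by (intro arcD(4)) (simp add: q vwalk_Cons_Cons_iff)
  ultimately have "length q < k"
    using hd_eq assms(4) lab by (cases "length q = k") auto
  then have "f u ! length p = f u ! length q"
    using hd_eq lab by (simp add: nth_append)
  then show False
    using lab assms(3) \<open>length q < k\<close> by (simp add: nth_eq_iff_index_eq)
qed

lemma k_geodetic_G: "k_geodetic k G"
  unfolding k_geodetic_def
proof (intro ballI allI impI)
  fix u v p q
  assume "uv_walk G u p v \<and> vwalk_length p \<le> k \<and> uv_walk G u q v \<and> vwalk_length q \<le> k"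
  moreover from this obtain p' q' where pq: "p = u # p'" "q = u # q'"
    unfolding uv_walk_def vwalk_def by (metis list.collapse)
  ultimately have walks: "vwalk (u # p') (with_proj G)" "vwalk (u # q') (with_proj G)"
    and len: "length p' \<le> k" "length q' \<le> k" and eq: "last (u # p') = last (u # q')"
    unfolding uv_walk_def by auto
  have "length p' = length q'"
    using no_shorter_vwalk[OF walks] no_shorter_vwalk[OF walks(2,1)] len eq
    by (metis linorder_neqE_nat)
  \<comment> \<open>Equal lengths drop the same prefix of \<open>f u\<close>, so the appended
    symbols agree.\<close>
  then have "map (\<lambda>v. last (f v)) p' = map (\<lambda>v. last (f v)) q'"
    using label_last[OF walks(1) len(1)] label_last[OF walks(2) len(2)] eq by simp
  then show "p = q"
    using vwalk_eqI[OF walks] pq by simp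
qed

lemma size_in_out_sizes: "n * (m - k) \<in> out_sizes n k"
proof -
  have "card (pverts G) = n" by (simp add: G_def)
  moreover have "card (parcs G) = n * (m - k)"
    using card_parcs_regular[OF out_degree_G] by (simp add: G_def)
  moreover have "out_regular G"
    using out_degree_G unfolding out_regular_def by blast
  ultimately show ?thesis
    unfolding out_sizes_def using pair_digraph_G k_geodetic_G by (intro CollectI exI[of _ G]) simp
qed

end

section \<open>The lower bound for every order, and the asymptotics\<close>

lemma ex_out_ge:
  assumes "k > 0" "m ^ k \<le> n"
  shows "n * (m - k) \<le> ex_out n k"
\<comment> \<open>For \<open>m < k\<close> the truncated difference \<open>m - k\<close> is
  0.\<close>
proof (cases "k \<le> m")
  case True
  define V where "V = {x :: nat list. distinct x \<and> length x = k \<and> set x \<subseteq> {..<m}}"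
  let ?L = "{x. set x \<subseteq> {..<m} \<and> length x = k}"
  have "V \<subseteq> ?L" "finite ?L" "card ?L = m ^ k"
    using finite_lists_length_eq[of "{..<m}" k] card_lists_length_eq[of "{..<m}" k]
    by (auto simp: V_def)
  then have "finite V" "card V \<le> card {..<n}"
    using assms(2) card_mono[of ?L V] by (auto intro: finite_subset)
  then obtain g where g: "inj_on g V" "g ` V \<subseteq> {..<n}"
    using card_le_inj[of V "{..<n}"] by auto
  have x0: "[0..<k] \<in> V" using True by (auto simp: V_def)
  define f where "f i = (if i \<in> g ` V then the_inv_into V g i else [0..<k])" for i
  have f: "f i \<in> V" for i
    using x0 the_inv_into_into[OF g(1)] by (auto simp: f_def)
  have fg: "g x < n \<and> f (g x) = x" if "x \<in> V" for x
    using that g by (auto simp: f_def the_inv_into_f_f)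
  interpret permutation_labelling n m k f g
    using assms(1) f fg by unfold_locales (auto simp: V_def)
  show ?thesis
    unfolding ex_out_def by (intro Max_ge finite_out_sizes size_in_out_sizes)
qed simp

lemma ex_out_ge_real:
  assumes "k > 0"
  shows "real n * (real n powr (1 / real k) - real k - 1) \<le> real (ex_out n k)"
proof (cases "n = 0")
  case False
  define r where "r = real n powr (1 / real k)"
  define m where "m = nat \<lfloor>r\<rfloor>"
  have m: "real m \<le> r" "r - 1 < real m"
    using floor_correct[of r] by (simp_all add: m_def r_def)
  have "real m ^ k \<le> r ^ k"
    using m(1) by (intro power_mono) auto
  also have "r ^ k = real n"
    using assms False by (simp add: r_def powr_power)
  finally have "m ^ k \<le> n"
    by (metis of_nat_le_iff of_nat_power)
  then have "real (n * (m - k)) \<le> real (ex_out n k)"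
    using ex_out_ge[OF assms] by (simp only: of_nat_le_iff)
  \<comment> \<open>Rounding \<open>r\<close> down costs less than 1, and truncated subtraction only
    increases \<open>m - k\<close>.\<close>
  moreover have "real n * (r - real k - 1) \<le> real n * real (m - k)"
    using m(2) by (intro mult_left_mono) auto
  ultimately show ?thesis
    by (simp add: r_def)
qed simp

theorem theorem4:
  fixes k :: nat
  assumes "k \<ge> 2"
  shows "(\<lambda>n. real (ex_out n k)) \<sim>[at_top] (\<lambda>n. real n powr (real (k + 1) / real k))"
proof (rule asymp_equiv_sandwich_real)
  define c where "c = 1 / real k"
  have c: "c > 0" and exponent: "real (k + 1) / real k = 1 + c"
    using assms by (simp_all add: c_def field_simps)
  \<comment> \<open>Since \<open>c > 0\<close>, the constant \<open>k + 1\<close> is negligible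
    against \<open>n powr c\<close>.\<close>
  show "(\<lambda>n. real n * (real n powr (1 / real k) - real k - 1))
      \<sim>[at_top] (\<lambda>n. real n powr (real (k + 1) / real k))"
    unfolding exponent unfolding c_def[symmetric] using c by real_asymp
  show "(\<lambda>n. real n * real n powr (1 / real k))
      \<sim>[at_top] (\<lambda>n. real n powr (real (k + 1) / real k))"
    unfolding exponent unfolding c_def[symmetric] using c by real_asymp
  show "\<forall>\<^sub>F n in at_top. real (ex_out n k) \<in>
      {real n * (real n powr (1 / real k) - real k - 1)..real n * real n powr (1 / real k)}"
    using assms ex_out_le ex_out_ge_real by (intro always_eventually) auto
qed

end
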